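(* Let $N$ be a positive integer, let $\nu$ be a finite Borel measure essentially supported on a fundamental domain $D$ of a closed subgroup $G$ of $\mathbb{R}^d$, and let $\mu=\mu_1+\cdots+\mu_N$ be a multi-tiling measure with respect to $G$ built from $\nu$, with associated functions $g_1,\ldots,g_N$ and determinant function $\mathfrak{D}_x$. Assume that $\mu$ has bounded support; in particular there is $M>0$ with $\max_{j\ne k}|g_j(x)-g_k(x)|\le M$ for $\nu$-a.e. $x$. Let $E$ be the set of all $x$ for which this inequality holds. Write $G=H\oplus\Gamma$ with $H$ a vector subspace of $\mathbb{R}^d$ and $\Gamma$ a discrete subgroup of $H^\perp$. Let $$\mathcal{M}=\{g_j(x)-g_k(x): j\ne k,\ x\in E\}\subset\mathcal{K}:=\bigcup_{i=0}^{R-1}\left(H_i\oplus\{\gamma_i\}\right),$$ where $H_0,\ldots,H_{R-1}$ are compact subsets of $H$ and $\gamma_0,\ldots,\gamma_{R-1}$ are distinct elements of $\Gamma$. Say that the determinant condition holds if there exist $\mathbf{t}=(t_1,\ldots,t_N)\in\mathbb{R}^{Nd}$ and $\epsilon_0>0$ such that $|\mathfrak{D}_x(\mathbf{t})|\ge\epsilon_0$ for $\nu$-a.e. $x$. Then: (a) If $0\notin\{\gamma_0,\ldots,\gamma_{R-1}\}$, then the determinant condition holds. (b) If $\gamma_0=0$ and there exist $\mathbf{w}\in H$ and $m>0$ such that $|\mathbf{w}\cdot\mathbf{x}|\ge m$ for all $\mathbf{x}\in H_0$, then the determinant condition holds. (c) If $\dim H=1$ and there exists $m>0$ such that $\min_{j\ne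 k}|g_j(x)-g_k(x)|\ge m$ for $\nu$-a.e. $x$, then the determinant condition holds.
   Context: $G$ is a closed additive subgroup of $\mathbb{R}^d$, not necessarily discrete; every such group can be written $G=H\oplus\Gamma$ with $H$ a vector subspace and $\Gamma\subset H^\perp$ a discrete subgroup, where $H^\perp$ is the orthogonal complement. A fundamental domain of $G$ is a Borel subset of $\mathbb{R}^d$ containing exactly one representative of each coset in $\mathbb{R}^d/G$. Multi-tiling measures. An essential support of a finite Borel measure $\rho$ is a Borel set $X_\rho$ with $\rho(X_\rho)=\rho(\mathbb{R}^d)$, denoted $\mathrm{supp}(\rho)$. Let $\nu$ be a finite Borel measure with essential support contained in $D$. Let $\mu_1,\ldots,\mu_N$ be finite Borel measures such that each $\mu_k$ has an essential support $X_k$ contained in some fundamental domain $D_k$ of $G$. Let $\pi_k:X_k\to D$ be the injective map sending $y$ to the unique element of $D\cap(y+G)$, and assume $\mu_k=\nu\circ\pi_k$, i.e. $\mu_k(B)=\nu(\pi_k(B\cap X_k))$ for every Borel set $B$. Assume $\mathrm{supp}(\nu)\subset\pi_k(X_k)$, so that for each $x\in\mathrm{supp}(\nu)$ and each $j$ there is a unique $g_j(x)\in G$ with $x+g_j(x)\in X_j$. If moreover $\mu=\mu_1+\cdots+\mu_N$ satisfies $\mu(X_j\cap X_k)=0$ for all $j\ne k$, then $\mu$ is called the multi-tiling measure of $\mu_1,\ldots,\mu_N$ with respect to $G$. For $\mathbf{t}=(t_1,\ldots,t_N)$ with $t_k\in\mathbb{R}^d$ and $x\in\mathrm{supp}(\nu)$,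 $M_x(\mathbf{t})$ is the $N\times N$ matrix with entries $(M_x(\mathbf{t}))_{j,k}=e^{2\pi i t_k\cdot g_j(x)}$, and $\mathfrak{D}_x(\mathbf{t})=\det M_x(\mathbf{t})$. $|\cdot|$ is the Euclidean norm on $\mathbb{R}^d$ (the absolute value on scalars). $H_i\oplus\{\gamma_i\}=\{h+\gamma_i:h\in H_i\}$. For $N=1$ the minimum over the empty set is $+\infty$ and the condition on the maximum is void. *)

theory Defs
  imports "HOL-Analysis.Analysis" "Jordan_Normal_Form.Determinant"
begin

definition additive_subgroup :: "(real^'d) set \<Rightarrow> bool" where
  "additive_subgroup G \<longleftrightarrow> 0 \<in> G \<and> (\<forall>x\<in>G. \<forall>y\<in>G. x + y \<in> G) \<and> (\<forall>x\<in>G. - x \<in> G)"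

definition fundamental_domain :: "(real^'d) set \<Rightarrow> (real^'d) set \<Rightarrow> bool" where
  "fundamental_domain G D \<longleftrightarrow> D \<in> sets borel \<and> (\<forall>x. \<exists>!z. z \<in> D \<and> z - x \<in> G)"

definition finite_borel_measure :: "(real^'d) measure \<Rightarrow> bool" where
  "finite_borel_measure \<rho> \<longleftrightarrow> finite_measure \<rho> \<and> sets \<rho> = sets borel"

definition essential_support :: "(real^'d) measure \<Rightarrow> (real^'d) set \<Rightarrow> bool" where
  "essential_support \<rho> X \<longleftrightarrow> X \<in> sets borel \<and> emeasure \<rho> X = emeasure \<rho> UNIV"

definition tile_proj :: "(real^'d) set \<Rightarrow> (real^'d) set \<Rightarrow> real^'d \<Rightarrow> real^'d" where
  "tile_proj G D y = (THE z. z \<in> D \<and> z - y \<in> G)"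

definition tile_shift :: "(real^'d) set \<Rightarrow> (nat \<Rightarrow> (real^'d) set) \<Rightarrow> nat \<Rightarrow> real^'d \<Rightarrow> real^'d" where
  "tile_shift G X j x = (THE g. g \<in> G \<and> x + g \<in> X j)"

text \<open>
  The tiles are indexed by \<open>k < N\<close>; \<open>S\<close> is the chosen essential support \<open>supp(\<nu>)\<close>, and
  \<open>\<mu>\<close> is the sum of the \<open>\<mu>s k\<close>. The formula \<open>\<mu>\<^sub>k(B) = \<nu>(\<pi>\<^sub>k(B \<inter> X\<^sub>k))\<close> presupposes that the
  image is Borel. This always holds by the Lusin--Souslin theorem, since \<open>\<pi>\<^sub>k\<close> is an injective
  Borel map; it is spelled out only because \<^const>\<open>emeasure\<close> is \<open>0\<close> by convention on
  non-measurable sets.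
\<close>

definition multi_tiling ::
  "(real^'d) set \<Rightarrow> (real^'d) set \<Rightarrow> nat \<Rightarrow> (real^'d) measure \<Rightarrow> (real^'d) set \<Rightarrow>
   (nat \<Rightarrow> (real^'d) measure) \<Rightarrow> (nat \<Rightarrow> (real^'d) set) \<Rightarrow> (real^'d) measure \<Rightarrow> bool" where
  "multi_tiling G D N \<nu> S \<mu>s X \<mu> \<longleftrightarrow>
     fundamental_domain G D \<and>
     finite_borel_measure \<nu> \<and> essential_support \<nu> S \<and> S \<subseteq> D \<and>
     (\<forall>k<N. finite_borel_measure (\<mu>s k) \<and> essential_support (\<mu>s k) (X k) \<and>
        (\<exists>Dk. fundamental_domain G Dk \<and> X k \<subseteq> Dk) \<and>
        (\<forall>B\<in>sets borel. tile_proj G D ` (B \<inter> X k) \<in> sets borel \<and>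
           emeasure (\<mu>s k) B = emeasure \<nu> (tile_proj G D ` (B \<inter> X k))) \<and>
        S \<subseteq> tile_proj G D ` X k) \<and>
     finite_borel_measure \<mu> \<and>
     (\<forall>B\<in>sets borel. emeasure \<mu> B = (\<Sum>k<N. emeasure (\<mu>s k) B)) \<and>
     (\<forall>j<N. \<forall>k<N. j \<noteq> k \<longrightarrow> emeasure \<mu> (X j \<inter> X k) = 0)"

definition bounded_support :: "(real^'d) measure \<Rightarrow> bool" where
  "bounded_support \<rho> \<longleftrightarrow> (\<exists>B. essential_support \<rho> B \<and> bounded B)"

definition tile_matrix ::
  "(real^'d) set \<Rightarrow> (nat \<Rightarrow> (real^'d) set) \<Rightarrow> nat \<Rightarrow> (nat \<Rightarrow> real^'d) \<Rightarrow> real^'d \<Rightarrow> complex mat" where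
  "tile_matrix G X N t x =
     Matrix.mat N N (\<lambda>(j, k). exp (2 * complex_of_real pi * \<i> *
       complex_of_real (inner (t k) (tile_shift G X j x))))"

definition tile_det ::
  "(real^'d) set \<Rightarrow> (nat \<Rightarrow> (real^'d) set) \<Rightarrow> nat \<Rightarrow> (nat \<Rightarrow> real^'d) \<Rightarrow> real^'d \<Rightarrow> complex" where
  "tile_det G X N t x = Determinant.det (tile_matrix G X N t x)"

definition determinant_condition ::
  "(real^'d) set \<Rightarrow> (nat \<Rightarrow> (real^'d) set) \<Rightarrow> nat \<Rightarrow> (real^'d) measure \<Rightarrow> bool" where
  "determinant_condition G X N \<nu> \<longleftrightarrow>
     (\<exists>t. \<exists>\<epsilon>0>0. AE x in \<nu>. \<epsilon>0 \<le> cmod (tile_det G X N t x))"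

text \<open>The functions \<open>g\<^sub>j\<close> are meaningful on \<open>S = supp(\<nu>)\<close> only, so \<open>E\<close> is a subset of \<open>S\<close>.\<close>

definition bounded_diff_set ::
  "(real^'d) set \<Rightarrow> (nat \<Rightarrow> (real^'d) set) \<Rightarrow> nat \<Rightarrow> (real^'d) set \<Rightarrow> real \<Rightarrow> (real^'d) set" where
  "bounded_diff_set G X N S M =
     {x\<in>S. \<forall>j<N. \<forall>k<N. j \<noteq> k \<longrightarrow> norm (tile_shift G X j x - tile_shift G X k x) \<le> M}"

definition shift_differences ::
  "(real^'d) set \<Rightarrow> (nat \<Rightarrow> (real^'d) set) \<Rightarrow> nat \<Rightarrow> (real^'d) set \<Rightarrow> (real^'d) set" where
  "shift_differences G X N E =
     {tile_shift G X j x - tile_shift G X k x | j k x. j < N \<and> k < N \<and> j \<noteq> k \<and> x \<in> E}"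

definition group_splitting :: "(real^'d) set \<Rightarrow> (real^'d) set \<Rightarrow> (real^'d) set \<Rightarrow> bool" where
  "group_splitting G H \<Gamma> \<longleftrightarrow>
     subspace H \<and> additive_subgroup \<Gamma> \<and> discrete \<Gamma> \<and> \<Gamma> \<subseteq> orthogonal_comp H \<and>
     G = {h + \<gamma> | h \<gamma>. h \<in> H \<and> \<gamma> \<in> \<Gamma>}"

definition compact_slices_cover ::
  "(real^'d) set \<Rightarrow> (real^'d) set \<Rightarrow> (real^'d) set \<Rightarrow>
   nat \<Rightarrow> (nat \<Rightarrow> (real^'d) set) \<Rightarrow> (nat \<Rightarrow> real^'d) \<Rightarrow> bool" where
  "compact_slices_cover \<M> H \<Gamma> R Hs \<gamma> \<longleftrightarrow>
     (\<forall>i<R. compact (Hs i) \<and> Hs i \<subseteq> H \<and> \<gamma> i \<in> \<Gamma>) \<and> inj_on \<gamma> {..<R} \<and>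
     \<M> \<subseteq> (\<Union>i<R. {h + \<gamma> i | h. h \<in> Hs i})"

end

theory Submission
  imports Defs
begin

text \<open>
  The idea is to look only at frequencies in arithmetic progression, \<open>t\<^sub>k = k v\<close> for a single
  vector \<open>v\<close>. The matrix \<open>M\<^sub>x(t)\<close> is then a Vandermonde matrix with nodes
  \<open>exp (2 \<pi> i v \<cdot> g\<^sub>j(x))\<close> on the unit circle, and its determinant is the product of the
  differences of the nodes. Hence it is bounded away from zero as soon as every
  \<open>v \<cdot> (g\<^sub>k(x) - g\<^sub>j(x))\<close> keeps a fixed distance from the integers.

  The differences are bounded, so a small multiple of \<open>v\<close> brings all these inner products into
  \<open>[-1/2, 1/2]\<close>, where the only integer to avoid is \<open>0\<close>. It therefore suffices to find a
  direction \<open>v\<close> and \<open>\<delta> > 0\<close> with \<open>\<bar>v \<cdot> y\<bar> \<ge> \<delta>\<close> for almost all differences \<open>y\<close>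
  (\<open>determinant_condition_of_separating_direction\<close>).

  Write \<open>y = h + \<gamma>\<close> with \<open>h \<in> H\<close> and \<open>\<gamma>\<close> in a finite subset of the orthogonal complement of
  \<open>H\<close>. Since finitely many hyperplanes do not fill the space, some \<open>p\<close> orthogonal to \<open>H\<close> has
  \<open>p \<cdot> \<gamma> \<noteq> 0\<close> for every nonzero \<open>\<gamma>\<close> that occurs, and \<open>p \<cdot> y = p \<cdot> \<gamma>\<close> takes only finitely
  many values. This takes care of the slices with \<open>\<gamma> \<noteq> 0\<close>. On the slice \<open>\<gamma> = 0\<close> the vector \<open>p\<close>
  sees nothing, so a vector \<open>w \<in> H\<close> with \<open>\<bar>w \<cdot> h\<bar> \<ge> m\<close> there is needed; adding a
  sufficiently small multiple of \<open>w\<close> to \<open>p\<close> does not spoil the other slices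
  (\<open>exists_separating_direction\<close>). The three parts differ only in the choice of \<open>w\<close>: in the
  first no slice has \<open>\<gamma> = 0\<close> and \<open>w = 0\<close> will do, in the second \<open>w\<close> is given, and in the third
  a unit vector \<open>w\<close> of the line \<open>H\<close> satisfies \<open>\<bar>w \<cdot> h\<bar> = \<bar>h\<bar> \<ge> m\<close>.

  The bound \<open>M\<close> comes from the fact that almost every \<open>x\<close> has all its translates
  \<open>x + g\<^sub>k(x)\<close> in a bounded essential support of \<open>\<mu>\<close>
  (\<open>AE_translates_in_support\<close>). The compact slices exist because a discrete subgroup meets
  every ball in a finite set.
\<close>

section \<open>Vandermonde determinants\<close>

lemma poly_eq_sum_upto:
  fixes p :: "'a::comm_semiring_1 poly"
  assumes "degree p < n"
  shows "poly p x = (\<Sum>i<n. coeff p i * x ^ i)"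
proof -
  have "(\<Sum>i\<le>degree p. coeff p i * x ^ i) = (\<Sum>i<n. coeff p i * x ^ i)"
    using assms by (intro sum.mono_neutral_left) (auto simp: coeff_eq_0)
  then show ?thesis
    by (simp add: poly_altdef)
qed

text \<open>
  Newton's basis polynomials \<open>P\<^sub>k = (X - z\<^sub>0) \<dots> (X - z\<^sub>k\<^sub>-\<^sub>1)\<close> are monic of degree \<open>k\<close>,
  so passing from the monomials to them multiplies the Vandermonde matrix by an upper unitriangular
  matrix. The product has entries \<open>P\<^sub>k(z\<^sub>j)\<close>, which vanish for \<open>j < k\<close>; its diagonal gives
  the determinant.
\<close>

lemma det_vandermonde:
  fixes z :: "nat \<Rightarrow> 'a::idom"
  shows "Determinant.det (Matrix.mat n n (\<lambda>(j, k). z j ^ k)) = (\<Prod>k<n. \<Prod>i<k. z k - z i)"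
proof -
  define P where "P k = (\<Prod>i<k. [:- z i, 1:])" for k
  have deg: "degree (P k) = k" for k
    unfolding P_def by (subst degree_prod_eq_sum_degree) auto
  have lead: "coeff (P k) k = 1" for k
  proof -
    have "lead_coeff (P k) = 1"
      unfolding P_def by (simp add: lead_coeff_prod)
    then show ?thesis by (simp add: deg)
  qed
  define V where "V = Matrix.mat n n (\<lambda>(j, k). z j ^ k)"
  define C where "C = Matrix.mat n n (\<lambda>(i, k). coeff (P k) i)"
  define W where "W = Matrix.mat n n (\<lambda>(j, k). poly (P k) (z j))"
  have VC: "V * C = W"
  proof (rule eq_matI)
    fix j k assume jk: "j < dim_row W" "k < dim_col W"
    then have "degree (P k) < n"
      by (simp add: deg W_def)
    from poly_eq_sum_upto[OF this, of "z j"] show "(V * C) $$ (j, k) = W $$ (j, k)"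
      using jk by (simp add: V_def C_def W_def scalar_prod_def mult.commute lessThan_atLeast0)
  qed (auto simp: V_def C_def W_def)
  have "Determinant.det C = prod_list (diag_mat C)"
  proof (rule det_upper_triangular[of _ n])
    show "upper_triangular C"
      by (auto simp: upper_triangular_def C_def coeff_eq_0 deg)
  qed (simp add: C_def)
  also have "\<dots> = 1"
    by (simp add: prod_list_diag_prod C_def lead)
  finally have detC: "Determinant.det C = 1" .
  have "Determinant.det W = prod_list (diag_mat W)"
  proof (rule det_lower_triangular[of n])
    fix i j :: nat assume "i < j" "j < n"
    then show "W $$ (i, j) = 0"
      by (auto simp: W_def P_def poly_prod)
  qed (simp add: W_def)
  also have "\<dots> = (\<Prod>k<n. \<Prod>i<k. z k - z i)"
    by (simp add: prod_list_diag_prod W_def P_def poly_prod lessThan_atLeast0)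
  finally have "Determinant.det (V * C) = (\<Prod>k<n. \<Prod>i<k. z k - z i)"
    by (simp add: VC)
  moreover have "Determinant.det (V * C) = Determinant.det V * Determinant.det C"
    by (rule det_mult[of _ n]) (simp_all add: V_def C_def)
  ultimately show ?thesis
    by (simp add: detC V_def)
qed

section \<open>From a separating direction to the determinant condition\<close>

text \<open>
  The chord between the points of the unit circle at angles \<open>2 \<pi> a\<close> and \<open>2 \<pi> b\<close> has length
  \<open>2 \<bar>sin (\<pi> (a - b))\<bar>\<close>, which increases with \<open>\<bar>a - b\<bar>\<close> up to \<open>1/2\<close>.
\<close>

lemma unit_circle_gap:
  fixes a b \<delta> :: real
  assumes "0 < \<delta>" "\<delta> \<le> \<bar>a - b\<bar>" "\<bar>a - b\<bar> \<le> 1/2"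
  shows "2 * sin (pi * \<delta>) \<le>
    cmod (exp (2 * complex_of_real pi * \<i> * a) - exp (2 * complex_of_real pi * \<i> * b))"
proof -
  let ?e = "\<lambda>s::real. exp (2 * complex_of_real pi * \<i> * s)"
  have "?e a = ?e b * exp (\<i> * complex_of_real (2 * pi * (a - b)))"
    by (simp add: mult_exp_exp algebra_simps)
  then have "?e a - ?e b = ?e b * (exp (\<i> * complex_of_real (2 * pi * (a - b))) - 1)"
    by (simp add: algebra_simps)
  then have "cmod (?e a - ?e b) = cmod (exp (\<i> * complex_of_real (2 * pi * (a - b))) - 1)"
    by (simp add: norm_mult)
  also have "\<dots> = 2 * \<bar>sin (pi * (a - b))\<bar>"
    unfolding dist_exp_i_1 by simp
  also have "\<bar>sin (pi * (a - b))\<bar> = \<bar>sin (pi * \<bar>a - b\<bar>)\<bar>"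
    by (metis abs_minus_cancel abs_real_def mult_minus_right sin_minus)
  finally have eq: "cmod (?e a - ?e b) = 2 * \<bar>sin (pi * \<bar>a - b\<bar>)\<bar>" .
  have "0 \<le> pi * \<delta>" using assms by simp
  moreover have "pi * \<delta> \<le> pi * \<bar>a - b\<bar>" using assms by (simp add: mult_left_mono)
  moreover have "pi * \<bar>a - b\<bar> \<le> pi / 2"
    using mult_left_mono[OF assms(3), of pi] by simp
  ultimately have "sin (pi * \<delta>) \<le> sin (pi * \<bar>a - b\<bar>)"
    by (intro sin_monotone_2pi_le) (use pi_ge_zero in linarith)+
  then show ?thesis
    unfolding eq by linarith
qed

lemma tile_det_arithmetic_progression:
  fixes v :: "real^'d"
  shows "tile_det G X N (\<lambda>k. real k *\<^sub>R v) x =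
    (\<Prod>k<N. \<Prod>i<k. exp (2 * complex_of_real pi * \<i> * (inner v (tile_shift G X k x))) -
       exp (2 * complex_of_real pi * \<i> * (inner v (tile_shift G X i x))))"
proof -
  let ?z = "\<lambda>j. exp (2 * complex_of_real pi * \<i> * (inner v (tile_shift G X j x)))"
  have "tile_matrix G X N (\<lambda>k. real k *\<^sub>R v) x = Matrix.mat N N (\<lambda>(j, k). ?z j ^ k)"
    unfolding tile_matrix_def
    by (intro cong_mat) (auto simp: exp_of_nat_mult[symmetric] algebra_simps)
  then show ?thesis
    by (simp add: tile_det_def det_vandermonde)
qed

text \<open>
  After rescaling \<open>v\<close> by \<open>c\<close> all inner products with the differences lie in \<open>[-1/2, 1/2]\<close>
  and are still at least \<open>c \<delta>\<close> in absolute value, so that every factor of the Vandermonde product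
  is bounded below by the same \<open>\<eta>\<close>.
\<close>

lemma determinant_condition_of_separating_direction:
  fixes v :: "real^'d"
  assumes "0 < \<delta>"
    and sep: "AE x in \<nu>. \<forall>j<N. \<forall>k<N. j \<noteq> k \<longrightarrow>
      norm (tile_shift G X j x - tile_shift G X k x) \<le> M \<and>
      \<delta> \<le> \<bar>inner v (tile_shift G X j x - tile_shift G X k x)\<bar>"
  shows "determinant_condition G X N \<nu>"
proof -
  define c where "c = 1 / (2 * (norm v * \<bar>M\<bar> + 1))"
  have den: "0 < norm v * \<bar>M\<bar> + 1"
    by (simp add: add_nonneg_pos)
  then have "0 < c" by (simp add: c_def)
  have upper: "\<bar>inner (c *\<^sub>R v) y\<bar> \<le> 1/2" if "norm y \<le> M" for y
  proof -
    have "\<bar>inner v y\<bar> \<le> norm v * \<bar>M\<bar>"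
      using Cauchy_Schwarz_ineq2[of v y] that
      by (meson abs_ge_self mult_left_mono norm_ge_zero order_trans)
    then have "c * \<bar>inner v y\<bar> \<le> c * (norm v * \<bar>M\<bar> + 1)"
      using \<open>0 < c\<close> by (intro mult_left_mono) auto
    also have "\<dots> = 1/2"
      using den by (simp add: c_def)
    finally show ?thesis
      using \<open>0 < c\<close> by (simp add: abs_mult)
  qed
  have lower: "c * \<delta> \<le> \<bar>inner (c *\<^sub>R v) y\<bar>" if "\<delta> \<le> \<bar>inner v y\<bar>" for y
    using that \<open>0 < c\<close> by (simp add: abs_mult)
  \<comment> \<open>If no differences occur, \<open>c * \<delta>\<close> may be so large that the sine of \<open>pi * (c * \<delta>)\<close>
    is not positive; truncating it at \<open>1/2\<close> excludes this.\<close>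
  define \<eta> where "\<eta> = 2 * sin (pi * min (c * \<delta>) (1/2))"
  have "0 < \<eta>"
  proof -
    have "0 < pi * min (c * \<delta>) (1/2)"
      using \<open>0 < c\<close> \<open>0 < \<delta>\<close> by simp
    moreover have "pi * min (c * \<delta>) (1/2) < pi"
      using mult_strict_left_mono[of "min (c * \<delta>) (1/2)" 1 pi] by simp
    ultimately show ?thesis
      unfolding \<eta>_def using sin_gt_zero by simp
  qed
  have "(\<Prod>k<N. \<Prod>i<k. \<eta>) \<le> cmod (tile_det G X N (\<lambda>k. real k *\<^sub>R (c *\<^sub>R v)) x)"
    if x: "\<forall>j<N. \<forall>k<N. j \<noteq> k \<longrightarrow>
      norm (tile_shift G X j x - tile_shift G X k x) \<le> M \<and>
      \<delta> \<le> \<bar>inner v (tile_shift G X j x - tile_shift G X k x)\<bar>" for x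
    unfolding tile_det_arithmetic_progression prod_norm[symmetric]
  proof (intro prod_mono conjI)
    fix k i assume ki: "k \<in> {..<N}" "i \<in> {..<k}"
    let ?a = "inner (c *\<^sub>R v) (tile_shift G X k x)" and ?b = "inner (c *\<^sub>R v) (tile_shift G X i x)"
    have "norm (tile_shift G X k x - tile_shift G X i x) \<le> M"
      "\<delta> \<le> \<bar>inner v (tile_shift G X k x - tile_shift G X i x)\<bar>"
      using x ki by auto
    from upper[OF this(1)] lower[OF this(2)]
    have "c * \<delta> \<le> \<bar>?a - ?b\<bar>" "\<bar>?a - ?b\<bar> \<le> 1/2"
      unfolding inner_diff_right by blast+
    then show "\<eta> \<le> cmod (exp (2 * complex_of_real pi * \<i> * ?a) - exp (2 * complex_of_real pi * \<i> * ?b))"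
      unfolding \<eta>_def using \<open>0 < c\<close> \<open>0 < \<delta>\<close> by (intro unit_circle_gap) auto
  qed (use \<open>0 < \<eta>\<close> in \<open>auto intro!: prod_nonneg\<close>)
  then have "AE x in \<nu>. (\<Prod>k<N. \<Prod>i<k. \<eta>) \<le> cmod (tile_det G X N (\<lambda>k. real k *\<^sub>R (c *\<^sub>R v)) x)"
    using sep by (auto elim!: eventually_mono)
  moreover have "0 < (\<Prod>k<N. \<Prod>i<k. \<eta>)"
    using \<open>0 < \<eta>\<close> by (simp add: prod_pos)
  ultimately show ?thesis
    unfolding determinant_condition_def by blast
qed

section \<open>Finding a separating direction\<close>

text \<open>
  The hyperplanes orthogonal to the elements of \<open>F\<close> are null sets, so some \<open>q\<close> avoids them all.
  An inner product with an element of \<open>F\<close> depends only on the component of \<open>q\<close> orthogonal to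
  \<open>H\<close>, and this component is the desired \<open>p\<close>.
\<close>

lemma exists_direction_off_hyperplanes:
  fixes F :: "'a::euclidean_space set"
  assumes "subspace H" "finite F" "F \<subseteq> orthogonal_comp H" "0 \<notin> F"
  obtains p where "p \<in> orthogonal_comp H" "\<And>\<gamma>. \<gamma> \<in> F \<Longrightarrow> inner p \<gamma> \<noteq> 0"
proof -
  have "negligible (\<Union>\<gamma>\<in>F. {x. inner \<gamma> x = 0})"
    using assms by (intro negligible_Union) (auto intro!: negligible_hyperplane)
  then have "(\<Union>\<gamma>\<in>F. {x. inner \<gamma> x = 0}) \<noteq> UNIV"
    using non_negligible_UNIV by metis
  then obtain q where q: "\<And>\<gamma>. \<gamma> \<in> F \<Longrightarrow> inner \<gamma> q \<noteq> 0"
    by auto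
  obtain h p where h: "h \<in> span H" and p: "\<And>y. y \<in> span H \<Longrightarrow> real_inner_class.orthogonal p y" and qhp: "q = h + p"
    using orthogonal_subspace_decomp_exists[of H q] by blast
  have span: "span H = H"
    using assms(1) by (simp add: span_eq_iff)
  have "inner p \<gamma> \<noteq> 0" if "\<gamma> \<in> F" for \<gamma>
  proof -
    have "inner h \<gamma> = 0"
      using that h assms(3) by (auto simp: span orthogonal_comp_def real_inner_class.orthogonal_def)
    then show ?thesis
      using q[OF that] by (simp add: qhp inner_add_right inner_commute)
  qed
  moreover have "p \<in> orthogonal_comp H"
    using p by (auto simp: span orthogonal_comp_def real_inner_class.orthogonal_def inner_commute)
  ultimately show thesis
    by (rule that[rotated])
qed

text \<open>
  The direction is \<open>v = p + s w\<close> with \<open>p\<close> orthogonal to \<open>H\<close>. For \<open>y = h + \<gamma>\<close> orthogonality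
  gives \<open>v \<cdot> y = p \<cdot> \<gamma> + s (w \<cdot> y)\<close>, where \<open>w \<cdot> y = w \<cdot> h\<close>. The number \<open>s\<close> is chosen so
  small that the second term is at most half of the smallest nonzero \<open>\<bar>p \<cdot> \<gamma>\<bar>\<close>; when
  \<open>\<gamma> = 0\<close> the second term stands alone.
\<close>

lemma exists_separating_direction:
  fixes F Y :: "'a::euclidean_space set"
  assumes H: "subspace H" and F: "finite F" "F \<subseteq> orthogonal_comp H"
    and w: "w \<in> H" and "0 < m"
    and bdd: "\<And>y. y \<in> Y \<Longrightarrow> norm y \<le> M"
    and dec: "\<And>y. y \<in> Y \<Longrightarrow>
      \<exists>h\<in>H. \<exists>\<gamma>\<in>F. y = h + \<gamma> \<and> (\<gamma> = 0 \<longrightarrow> m \<le> \<bar>inner w h\<bar>)"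
  obtains v \<delta> where "0 < \<delta>" "\<And>y. y \<in> Y \<Longrightarrow> \<delta> \<le> \<bar>inner v y\<bar>"
proof -
  obtain p where p: "p \<in> orthogonal_comp H" and p_off: "\<And>\<gamma>. \<gamma> \<in> F - {0} \<Longrightarrow> inner p \<gamma> \<noteq> 0"
    using exists_direction_off_hyperplanes[of H "F - {0}"] H F by blast
  obtain d where "0 < d" and d: "\<And>\<gamma>. \<gamma> \<in> F - {0} \<Longrightarrow> d \<le> \<bar>inner p \<gamma>\<bar>"
  proof
    \<comment> \<open>The element \<open>1\<close> makes the minimum meaningful when \<open>F\<close> has no nonzero element.\<close>
    let ?A = "insert 1 ((\<lambda>\<gamma>. \<bar>inner p \<gamma>\<bar>) ` (F - {0}))"
    show "0 < Min ?A"
      using F(1) p_off by (subst Min_gr_iff) auto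
    show "Min ?A \<le> \<bar>inner p \<gamma>\<bar>" if "\<gamma> \<in> F - {0}" for \<gamma>
      using F(1) that by (intro Min_le) auto
  qed
  define s where "s = d / (2 * (norm w * \<bar>M\<bar> + 1))"
  have den: "0 < norm w * \<bar>M\<bar> + 1"
    by (simp add: add_nonneg_pos)
  then have "0 < s" using \<open>0 < d\<close> by (simp add: s_def)
  have "min (s * m) (d / 2) \<le> \<bar>inner (p + s *\<^sub>R w) y\<bar>" if y: "y \<in> Y" for y
  proof -
    obtain h \<gamma> where h: "h \<in> H" and \<gamma>: "\<gamma> \<in> F" and yh: "y = h + \<gamma>"
      and low: "\<gamma> = 0 \<Longrightarrow> m \<le> \<bar>inner w h\<bar>"
      using dec[OF y] by blast
    have "inner p h = 0"
      using p h by (auto simp: orthogonal_comp_def real_inner_class.orthogonal_def inner_commute)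
    then have py: "inner p y = inner p \<gamma>"
      by (simp add: yh inner_add_right)
    have "inner w \<gamma> = 0"
      using w \<gamma> F(2) by (auto simp: orthogonal_comp_def real_inner_class.orthogonal_def)
    then have wy: "inner w y = inner w h"
      by (simp add: yh inner_add_right)
    have v: "inner (p + s *\<^sub>R w) y = inner p \<gamma> + s * inner w y"
      by (simp add: inner_add_left py)
    show ?thesis
    proof (cases "\<gamma> = 0")
      case True
      then have "s * m \<le> s * \<bar>inner w y\<bar>"
        using low \<open>0 < s\<close> by (simp add: wy)
      then show ?thesis
        using True \<open>0 < s\<close> by (simp add: v abs_mult min.coboundedI1)
    next
      case False
      then have low_p: "d \<le> \<bar>inner p \<gamma>\<bar>"
        using d \<gamma> by blast
      have "\<bar>inner w y\<bar> \<le> norm w * \<bar>M\<bar>"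
        using Cauchy_Schwarz_ineq2[of w y] bdd[OF y]
        by (meson abs_ge_self mult_left_mono norm_ge_zero order_trans)
      then have "s * \<bar>inner w y\<bar> \<le> s * (norm w * \<bar>M\<bar> + 1)"
        using \<open>0 < s\<close> by (intro mult_left_mono) auto
      also have "\<dots> = d / 2"
        using den by (simp add: s_def divide_simps)
      finally have "\<bar>s * inner w y\<bar> \<le> d / 2"
        using \<open>0 < s\<close> by (simp add: abs_mult)
      with low_p show ?thesis
        unfolding v by linarith
    qed
  qed
  moreover have "0 < min (s * m) (d / 2)"
    using \<open>0 < s\<close> \<open>0 < d\<close> \<open>0 < m\<close> by simp
  ultimately show thesis
    using that by blast
qed

lemma subspace_dim_1_inner:
  fixes H :: "'a::euclidean_space set"
  assumes "subspace H" "dim H = 1"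
  obtains w where "w \<in> H" "\<And>h. h \<in> H \<Longrightarrow> \<bar>inner w h\<bar> = norm h"
proof -
  obtain B where B: "B \<subseteq> H" "pairwise real_inner_class.orthogonal B" "\<And>x. x \<in> B \<Longrightarrow> norm x = 1"
    "card B = dim H" "span B = H"
    using orthonormal_basis_subspace[OF assms(1)] by metis
  then obtain w where w: "B = {w}"
    using assms(2) card_1_singletonE by metis
  then have "norm w = 1" "w \<in> H" using B by auto
  moreover have "\<bar>inner w h\<bar> = norm h" if h: "h \<in> H" for h
  proof -
    obtain c where "h = c *\<^sub>R w"
      using h B(5) unfolding w by (auto simp: span_singleton)
    then show ?thesis
      using \<open>norm w = 1\<close> by (simp add: dot_square_norm)
  qed
  ultimately show thesis
    using that by blast
qed

text \<open>
  The common form of the three sufficient conditions: only the slice over \<open>\<gamma> = 0\<close> requires a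
  hypothesis. It is stated for the differences that actually occur, outside a null set, rather
  than for all points of the slice, because a lower bound on the norms of the differences says
  nothing about the other points of the covering sets.
\<close>

lemma determinant_condition_of_slices:
  fixes H \<Gamma> :: "(real^'d) set"
  assumes split: "group_splitting G H \<Gamma>"
    and cover: "compact_slices_cover (shift_differences G X N (bounded_diff_set G X N S M)) H \<Gamma> R Hs \<gamma>"
    and bdd: "AE x in \<nu>. x \<in> bounded_diff_set G X N S M"
    and w: "w \<in> H" and "0 < m"
    and zero: "AE x in \<nu>. \<forall>j<N. \<forall>k<N. \<forall>i<R. \<forall>h\<in>Hs i. j \<noteq> k \<longrightarrow>
      tile_shift G X j x - tile_shift G X k x = h + \<gamma> i \<longrightarrow> \<gamma> i = 0 \<longrightarrow> m \<le> \<bar>inner w h\<bar>"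
  shows "determinant_condition G X N \<nu>"
proof -
  let ?diff = "\<lambda>j k x. tile_shift G X j x - tile_shift G X k x"
  let ?good = "\<lambda>x. x \<in> bounded_diff_set G X N S M \<and> (\<forall>j<N. \<forall>k<N. \<forall>i<R. \<forall>h\<in>Hs i. j \<noteq> k \<longrightarrow>
      ?diff j k x = h + \<gamma> i \<longrightarrow> \<gamma> i = 0 \<longrightarrow> m \<le> \<bar>inner w h\<bar>)"
  define Y where "Y = {?diff j k x | j k x. j < N \<and> k < N \<and> j \<noteq> k \<and> ?good x}"
  have H: "subspace H" and \<Gamma>: "\<Gamma> \<subseteq> orthogonal_comp H"
    using split by (auto simp: group_splitting_def)
  have Hs: "Hs i \<subseteq> H" "\<gamma> i \<in> \<Gamma>" if "i < R" for i
    using cover that by (auto simp: compact_slices_cover_def)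
  have fin: "finite (\<gamma> ` {..<R})" and orth: "\<gamma> ` {..<R} \<subseteq> orthogonal_comp H"
    using Hs \<Gamma> by auto
  have Ybdd: "norm y \<le> M" if "y \<in> Y" for y
    using that by (auto simp: Y_def bounded_diff_set_def)
  have Ydec: "\<exists>h\<in>H. \<exists>g\<in>\<gamma> ` {..<R}. y = h + g \<and> (g = 0 \<longrightarrow> m \<le> \<bar>inner w h\<bar>)" if yY: "y \<in> Y" for y
  proof -
    obtain j k x where jk: "j < N" "k < N" "j \<noteq> k" and x: "?good x" and y: "y = ?diff j k x"
      using yY unfolding Y_def by blast
    then have "y \<in> shift_differences G X N (bounded_diff_set G X N S M)"
      by (auto simp: shift_differences_def)
    then have "y \<in> (\<Union>i<R. {h + \<gamma> i | h. h \<in> Hs i})"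
      using cover unfolding compact_slices_cover_def by blast
    then obtain i h where i: "i < R" "h \<in> Hs i" "y = h + \<gamma> i"
      by auto
    then have "\<gamma> i = 0 \<longrightarrow> m \<le> \<bar>inner w h\<bar>"
      using x[THEN conjunct2, rule_format, OF jk(1,2) i(1,2) jk(3)] i(3) y by simp
    then show ?thesis
      using i Hs by blast
  qed
  obtain v \<delta> where "0 < \<delta>" and v: "\<And>y. y \<in> Y \<Longrightarrow> \<delta> \<le> \<bar>inner v y\<bar>"
    using exists_separating_direction[OF H fin orth w \<open>0 < m\<close> Ybdd Ydec] by blast
  have "AE x in \<nu>. ?good x"
    using bdd zero by (rule AE_conjI)
  then have "AE x in \<nu>. \<forall>j<N. \<forall>k<N. j \<noteq> k \<longrightarrow> norm (?diff j k x) \<le> M \<and> \<delta> \<le> \<bar>inner v (?diff j k x)\<bar>"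
  proof (rule eventually_mono, intro allI impI)
    fix x j k assume "?good x" "j < N" "k < N" "j \<noteq> k"
    then have "?diff j k x \<in> Y"
      unfolding Y_def by blast
    then show "norm (?diff j k x) \<le> M \<and> \<delta> \<le> \<bar>inner v (?diff j k x)\<bar>"
      using Ybdd v by blast
  qed
  with \<open>0 < \<delta>\<close> show ?thesis
    by (rule determinant_condition_of_separating_direction)
qed

section \<open>Shifts of a multi-tiling measure\<close>

lemma tile_proj_eq:
  assumes "fundamental_domain G D" "z \<in> D" "z - y \<in> G"
  shows "tile_proj G D y = z"
proof -
  have "\<exists>!z. z \<in> D \<and> z - y \<in> G"
    using assms(1) unfolding fundamental_domain_def by blast
  then show ?thesis
    unfolding tile_proj_def by (rule the1_equality) (simp add: assms)
qed

lemma tile_proj_props: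
  assumes "fundamental_domain G D"
  shows "tile_proj G D y \<in> D" "tile_proj G D y - y \<in> G"
proof -
  have "\<exists>!z. z \<in> D \<and> z - y \<in> G"
    using assms unfolding fundamental_domain_def by blast
  from theI'[OF this] show "tile_proj G D y \<in> D" "tile_proj G D y - y \<in> G"
    unfolding tile_proj_def by auto
qed

text \<open>
  Existence of the shift comes from \<open>x\<close> being the projection of a point of \<open>X k\<close>, uniqueness
  from \<open>X k\<close> containing at most one point of each coset of \<open>G\<close>.
\<close>

lemma tile_shift_props:
  assumes G: "additive_subgroup G" and D: "fundamental_domain G D"
    and Dk: "fundamental_domain G Dk" "X k \<subseteq> Dk" and x: "x \<in> tile_proj G D ` X k"
  shows "tile_shift G X k x \<in> G" "x + tile_shift G X k x \<in> X k"
proof -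
  obtain y where y: "y \<in> X k" "x = tile_proj G D y"
    using x by blast
  then have "- (x - y) \<in> G"
    using tile_proj_props(2)[OF D, of y] G unfolding additive_subgroup_def by blast
  then have "y - x \<in> G \<and> x + (y - x) \<in> X k"
    using y by simp
  moreover have "g = g'" if "g \<in> G \<and> x + g \<in> X k" "g' \<in> G \<and> x + g' \<in> X k" for g g'
  proof -
    have "tile_proj G Dk x = x + g" "tile_proj G Dk x = x + g'"
      using that Dk by (auto intro!: tile_proj_eq)
    then show ?thesis by simp
  qed
  ultimately have "\<exists>!g. g \<in> G \<and> x + g \<in> X k"
    by blast
  from theI'[OF this] show "tile_shift G X k x \<in> G" "x + tile_shift G X k x \<in> X k"
    by (auto simp: tile_shift_def)
qed

lemma essential_support_null:
  assumes "finite_borel_measure \<rho>" "essential_support \<rho> B"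
  shows "- B \<in> null_sets \<rho>"
proof -
  have s: "sets \<rho> = sets borel" and fin: "finite_measure \<rho>"
    using assms by (auto simp: finite_borel_measure_def)
  have B: "B \<in> sets \<rho>" "emeasure \<rho> B = emeasure \<rho> UNIV"
    using assms s by (auto simp: essential_support_def)
  have sp: "space \<rho> = UNIV"
    using sets_eq_imp_space_eq[OF s] by simp
  interpret finite_measure \<rho> by fact
  have "emeasure \<rho> (space \<rho> - B) = emeasure \<rho> (space \<rho>) - emeasure \<rho> B"
    using B(1) by (intro emeasure_compl) auto
  then have "emeasure \<rho> (- B) = 0"
    by (simp add: sp B(2) Compl_eq_Diff_UNIV[symmetric])
  moreover have "- B \<in> sets \<rho>"
    using B(1) s by auto
  ultimately show ?thesis
    by (simp add: null_sets_def)
qed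

lemma multi_tiling_shift:
  assumes mt: "multi_tiling G D N \<nu> S \<mu>s X \<mu>" and G: "additive_subgroup G"
    and k: "k < N" and x: "x \<in> S"
  shows "tile_shift G X k x \<in> G" "x + tile_shift G X k x \<in> X k"
proof -
  have D: "fundamental_domain G D"
    using mt by (auto simp: multi_tiling_def)
  obtain Dk where Dk: "fundamental_domain G Dk" "X k \<subseteq> Dk"
    using mt k unfolding multi_tiling_def by blast
  have xk: "x \<in> tile_proj G D ` X k"
    using mt k x unfolding multi_tiling_def by blast
  show "tile_shift G X k x \<in> G" "x + tile_shift G X k x \<in> X k"
    using tile_shift_props[of G D Dk X k x, OF G D Dk xk] by blast+
qed

text \<open>
  If \<open>x + g\<^sub>k(x)\<close> misses \<open>B\<close>, then \<open>x\<close> lies in the projection of \<open>X k - B\<close>. The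
  \<open>\<nu>\<close>-measure of this projection is \<open>\<mu>\<^sub>k(- B) \<le> \<mu>(- B) = 0\<close>.
\<close>

lemma AE_translates_in_support:
  assumes mt: "multi_tiling G D N \<nu> S \<mu>s X \<mu>" and G: "additive_subgroup G"
    and B: "essential_support \<mu> B"
  shows "AE x in \<nu>. x \<in> S \<and> (\<forall>k<N. x + tile_shift G X k x \<in> B)"
proof -
  have D: "fundamental_domain G D" and "finite_borel_measure \<nu>" "essential_support \<nu> S"
    and SD: "S \<subseteq> D" and \<mu>: "finite_borel_measure \<mu>"
    using mt by (auto simp: multi_tiling_def)
  have sets\<nu>: "sets \<nu> = sets borel"
    using \<open>finite_borel_measure \<nu>\<close> by (simp add: finite_borel_measure_def)
  have Bc: "- B \<in> sets borel"
    using B by (auto simp: essential_support_def)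
  have "AE x in \<nu>. x \<in> S"
    using AE_not_in[OF essential_support_null[OF \<open>finite_borel_measure \<nu>\<close> \<open>essential_support \<nu> S\<close>]]
    by simp
  moreover have "AE x in \<nu>. \<forall>k\<in>{..<N}. x \<notin> tile_proj G D ` (- B \<inter> X k)"
  proof (rule AE_finite_allI)
    fix k assume "k \<in> {..<N}"
    then have k: "k < N" by simp
    have "emeasure \<mu> (- B) = 0"
      using essential_support_null[OF \<mu> B] by (simp add: null_sets_def)
    moreover have "emeasure \<mu> (- B) = (\<Sum>k<N. emeasure (\<mu>s k) (- B))"
      using mt Bc unfolding multi_tiling_def by blast
    ultimately have "emeasure (\<mu>s k) (- B) = 0"
      using k by simp
    then have "emeasure \<nu> (tile_proj G D ` (- B \<inter> X k)) = 0"
      using mt k Bc unfolding multi_tiling_def by metis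
    moreover have "tile_proj G D ` (- B \<inter> X k) \<in> sets \<nu>"
      unfolding sets\<nu> using mt k Bc unfolding multi_tiling_def by blast
    ultimately show "AE x in \<nu>. x \<notin> tile_proj G D ` (- B \<inter> X k)"
      by (intro AE_not_in) (simp add: null_sets_def)
  qed simp
  ultimately show ?thesis
  proof eventually_elim
    case (elim x)
    have "x + tile_shift G X k x \<in> B" if k: "k < N" for k
    proof (rule ccontr)
      let ?g = "tile_shift G X k x"
      assume nB: "x + ?g \<notin> B"
      have g: "?g \<in> G" "x + ?g \<in> X k"
        using multi_tiling_shift[OF mt G k] elim by blast+
      then have "tile_proj G D (x + ?g) = x"
        using D G SD elim by (intro tile_proj_eq) (auto simp: additive_subgroup_def)
      then have "x \<in> tile_proj G D ` (- B \<inter> X k)"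
        using g nB by (metis ComplI IntI imageI)
      then show False using elim k by blast
    qed
    then show ?case using elim by blast
  qed
qed

lemma AE_bounded_diff_set:
  assumes mt: "multi_tiling G D N \<nu> S \<mu>s X \<mu>" and G: "additive_subgroup G"
    and B: "bounded_support \<mu>"
  shows "\<exists>M>0. AE x in \<nu>. x \<in> bounded_diff_set G X N S M"
proof -
  obtain B where B: "essential_support \<mu> B" "bounded B"
    using assms(3) by (auto simp: bounded_support_def)
  obtain b where "0 < b" and b: "\<And>y. y \<in> B \<Longrightarrow> norm y \<le> b"
    using bounded_pos B(2) by blast
  have "AE x in \<nu>. x \<in> bounded_diff_set G X N S (2 * b)"
    using AE_translates_in_support[OF mt G B(1)]
  proof eventually_elim
    case (elim x)
    have "norm (tile_shift G X j x - tile_shift G X k x) \<le> 2 * b" if "j < N" "k < N" for j k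
    proof -
      have "norm ((x + tile_shift G X j x) - (x + tile_shift G X k x)) \<le> b + b"
        using elim that b by (intro norm_triangle_le_diff add_mono) auto
      then show ?thesis by simp
    qed
    with elim show ?case
      by (auto simp: bounded_diff_set_def)
  qed
  then show ?thesis
    using \<open>0 < b\<close> by (intro exI[of _ "2 * b"]) auto
qed

section \<open>Existence of compact slices\<close>

text \<open>
  Translation invariance spreads the isolation radius at \<open>0\<close> to all points, so a discrete
  subgroup is uniformly discrete. Discreteness of a mere set would not suffice, since its points
  may accumulate inside the ball.
\<close>

lemma discrete_subgroup_finite_ball:
  fixes \<Gamma> :: "(real^'d) set"
  assumes G: "additive_subgroup \<Gamma>" and "discrete \<Gamma>"
  shows "finite (\<Gamma> \<inter> cball 0 M)"
proof -
  have "0 isolated_in \<Gamma>"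
    using assms by (auto simp: additive_subgroup_def discrete_def)
  then obtain e where "0 < e" and e: "\<And>y. y \<in> \<Gamma> \<Longrightarrow> dist 0 y < e \<Longrightarrow> y = 0"
    by (auto simp: isolated_in_dist_Ex_iff)
  have "x = y" if "x \<in> \<Gamma>" "y \<in> \<Gamma>" "dist x y < e" for x y
  proof -
    have "x + - y \<in> \<Gamma>"
      using G that unfolding additive_subgroup_def by blast
    then have "x + - y = 0"
      using that(3) by (intro e) (simp_all add: dist_norm norm_minus_commute)
    then show ?thesis by simp
  qed
  then have "uniform_discrete \<Gamma>"
    using \<open>0 < e\<close> by (auto simp: uniform_discrete_def)
  then have "uniform_discrete (\<Gamma> \<inter> cball 0 M)"
    by (rule uniform_discrete_subset) simp
  moreover have "bounded (\<Gamma> \<inter> cball 0 M)"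
    by (simp add: bounded_Int)
  ultimately show ?thesis
    by (simp add: uniform_discrete_finite_iff[symmetric])
qed

text \<open>
  By Pythagoras both components of a difference \<open>h + \<gamma>\<close> of norm at most \<open>M\<close> have norm at most
  \<open>M\<close>. Hence only finitely many \<open>\<gamma>\<close> occur, and \<open>H \<inter> cball 0 M\<close> serves as the compact set for
  each of them.
\<close>

lemma exists_compact_slices_cover:
  assumes mt: "multi_tiling G D N \<nu> S \<mu>s X \<mu>" and G: "additive_subgroup G"
    and split: "group_splitting G H \<Gamma>"
  shows "\<exists>R Hs \<gamma>. compact_slices_cover
    (shift_differences G X N (bounded_diff_set G X N S M)) H \<Gamma> R Hs \<gamma>"
proof -
  have H: "subspace H" and \<Gamma>: "additive_subgroup \<Gamma>" "discrete \<Gamma>" "\<Gamma> \<subseteq> orthogonal_comp H"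
    and GH: "G = {h + \<gamma> | h \<gamma>. h \<in> H \<and> \<gamma> \<in> \<Gamma>}"
    using split by (auto simp: group_splitting_def)
  define F where "F = \<Gamma> \<inter> cball 0 M"
  have "finite F"
    unfolding F_def by (rule discrete_subgroup_finite_ball[OF \<Gamma>(1,2)])
  then obtain \<gamma> where \<gamma>: "bij_betw \<gamma> {..<card F} F"
    using ex_bij_betw_nat_finite[of F] by (auto simp: lessThan_atLeast0)
  then have img: "\<gamma> ` {..<card F} = F" and inj: "inj_on \<gamma> {..<card F}"
    by (auto simp: bij_betw_def)
  have dec: "\<exists>i<card F. \<exists>h\<in>H \<inter> cball 0 M. y = h + \<gamma> i"
    if yY: "y \<in> shift_differences G X N (bounded_diff_set G X N S M)" for y
  proof -
    obtain j k x where jk: "j < N" "k < N" "j \<noteq> k" and x: "x \<in> bounded_diff_set G X N S M"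
      and y: "y = tile_shift G X j x - tile_shift G X k x"
      using yY by (auto simp: shift_differences_def)
    have yM: "norm y \<le> M" and "x \<in> S"
      using x jk by (auto simp: y bounded_diff_set_def)
    have "tile_shift G X j x + - tile_shift G X k x \<in> G"
      using multi_tiling_shift(1)[OF mt G _ \<open>x \<in> S\<close>] jk G unfolding additive_subgroup_def by blast
    then obtain h g where h: "h \<in> H" "g \<in> \<Gamma>" "y = h + g"
      unfolding y GH by auto
    have "real_inner_class.orthogonal h g"
      using h \<Gamma>(3) by (auto simp: orthogonal_comp_def)
    then have "(norm y)\<^sup>2 = (norm h)\<^sup>2 + (norm g)\<^sup>2"
      unfolding h(3) by (rule norm_add_Pythagorean)
    then have "norm h \<le> norm y" "norm g \<le> norm y"
      by (auto intro: power2_le_imp_le)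
    then have "h \<in> H \<inter> cball 0 M" "g \<in> F"
      using h yM by (auto simp: F_def)
    moreover obtain i where "i < card F" "g = \<gamma> i"
      using \<open>g \<in> F\<close> img by auto
    ultimately show ?thesis
      using h(3) by blast
  qed
  have cpt: "compact (H \<inter> cball 0 M)"
    using H by (simp add: closed_subspace closed_Int_compact)
  have "compact_slices_cover (shift_differences G X N (bounded_diff_set G X N S M)) H \<Gamma>
      (card F) (\<lambda>_. H \<inter> cball 0 M) \<gamma>"
    unfolding compact_slices_cover_def
  proof (intro conjI allI impI subsetI)
    show "\<gamma> i \<in> \<Gamma>" if "i < card F" for i
      using img that by (auto simp: F_def)
    show "y \<in> (\<Union>i<card F. {h + \<gamma> i |h. h \<in> H \<inter> cball 0 M})"
      if "y \<in> shift_differences G X N (bounded_diff_set G X N S M)" for y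
      using dec[OF that] by blast
  qed (use inj cpt in auto)
  then show ?thesis by blast
qed

section \<open>The determinant condition\<close>

theorem theorem4p3:
  fixes G D H \<Gamma> S :: "(real^'d) set" and N :: nat
    and \<nu> \<mu> :: "(real^'d) measure" and \<mu>s :: "nat \<Rightarrow> (real^'d) measure"
    and X :: "nat \<Rightarrow> (real^'d) set"
  assumes "0 < N"
    and "closed G" and "additive_subgroup G"
    and "multi_tiling G D N \<nu> S \<mu>s X \<mu>"
    and "bounded_support \<mu>"
    and "group_splitting G H \<Gamma>"
  shows "(\<exists>M>0. AE x in \<nu>. x \<in> bounded_diff_set G X N S M) \<and>
    (\<forall>M>0. (AE x in \<nu>. x \<in> bounded_diff_set G X N S M) \<longrightarrow>
      (\<exists>R Hs \<gamma>. compact_slices_cover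
          (shift_differences G X N (bounded_diff_set G X N S M)) H \<Gamma> R Hs \<gamma>) \<and>
      (\<forall>R Hs \<gamma>. compact_slices_cover
          (shift_differences G X N (bounded_diff_set G X N S M)) H \<Gamma> R Hs \<gamma> \<longrightarrow>
        (0 \<notin> \<gamma> ` {..<R} \<longrightarrow> determinant_condition G X N \<nu>) \<and>
        (0 < R \<and> \<gamma> 0 = 0 \<and> (\<exists>w\<in>H. \<exists>m>0. \<forall>h\<in>Hs 0. m \<le> \<bar>inner w h\<bar>) \<longrightarrow>
           determinant_condition G X N \<nu>) \<and>
        (dim H = 1 \<and>
         (\<exists>m>0. AE x in \<nu>. \<forall>j<N. \<forall>k<N. j \<noteq> k \<longrightarrow>
            m \<le> norm (tile_shift G X j x - tile_shift G X k x)) \<longrightarrow>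
           determinant_condition G X N \<nu>)))"
proof (intro conjI allI impI)
  note G = \<open>additive_subgroup G\<close> and mt = \<open>multi_tiling G D N \<nu> S \<mu>s X \<mu>\<close>
    and split = \<open>group_splitting G H \<Gamma>\<close>
  show "\<exists>M>0. AE x in \<nu>. x \<in> bounded_diff_set G X N S M"
    using AE_bounded_diff_set[OF mt G \<open>bounded_support \<mu>\<close>] .
  fix M :: real
  assume bdd: "AE x in \<nu>. x \<in> bounded_diff_set G X N S M"
  show "\<exists>R Hs \<gamma>. compact_slices_cover
      (shift_differences G X N (bounded_diff_set G X N S M)) H \<Gamma> R Hs \<gamma>"
    using exists_compact_slices_cover[OF mt G split] .
  fix R Hs and \<gamma> :: "nat \<Rightarrow> real^'d"
  assume cover: "compact_slices_cover
    (shift_differences G X N (bounded_diff_set G X N S M)) H \<Gamma> R Hs \<gamma>"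
  have H: "subspace H"
    using split by (simp add: group_splitting_def)
  note criterion = determinant_condition_of_slices[OF split cover bdd]
  {
    assume "0 \<notin> \<gamma> ` {..<R}"
    then have "\<gamma> i \<noteq> 0" if "i < R" for i
      using that by (metis imageI lessThan_iff)
    then show "determinant_condition G X N \<nu>"
      by (intro criterion[of 0 1]) (auto simp: subspace_0[OF H])
  next
    assume b: "0 < R \<and> \<gamma> 0 = 0 \<and> (\<exists>w\<in>H. \<exists>m>0. \<forall>h\<in>Hs 0. m \<le> \<bar>inner w h\<bar>)"
    then obtain w m where w: "w \<in> H" "0 < m" "\<forall>h\<in>Hs 0. m \<le> \<bar>inner w h\<bar>"
      by blast
    \<comment> \<open>As the \<open>\<gamma> i\<close> are distinct, \<open>Hs 0\<close> is the only slice over \<open>0\<close>.\<close>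
    have "i = 0" if "i < R" "\<gamma> i = 0" for i
      using cover b that inj_onD[of \<gamma> "{..<R}" i 0] by (auto simp: compact_slices_cover_def)
    then have "m \<le> \<bar>inner w h\<bar>" if "i < R" "h \<in> Hs i" "\<gamma> i = 0" for i h
      using that w(3) by metis
    then show "determinant_condition G X N \<nu>"
      by (intro criterion[OF w(1,2)]) auto
  next
    assume "dim H = 1 \<and> (\<exists>m>0. AE x in \<nu>. \<forall>j<N. \<forall>k<N. j \<noteq> k \<longrightarrow>
      m \<le> norm (tile_shift G X j x - tile_shift G X k x))"
    then obtain m where "dim H = 1" "0 < m"
      and m: "AE x in \<nu>. \<forall>j<N. \<forall>k<N. j \<noteq> k \<longrightarrow> m \<le> norm (tile_shift G X j x - tile_shift G X k x)"
      by blast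
    obtain w where w: "w \<in> H" "\<And>h. h \<in> H \<Longrightarrow> \<bar>inner w h\<bar> = norm h"
      using subspace_dim_1_inner[OF H \<open>dim H = 1\<close>] by blast
    have Hs: "h \<in> H" if "i < R" "h \<in> Hs i" for i h
      using cover that by (auto simp: compact_slices_cover_def)
    show "determinant_condition G X N \<nu>"
    proof (rule criterion[OF w(1) \<open>0 < m\<close>])
      show "AE x in \<nu>. \<forall>j<N. \<forall>k<N. \<forall>i<R. \<forall>h\<in>Hs i. j \<noteq> k \<longrightarrow>
        tile_shift G X j x - tile_shift G X k x = h + \<gamma> i \<longrightarrow> \<gamma> i = 0 \<longrightarrow> m \<le> \<bar>inner w h\<bar>"
        using m by eventually_elim (metis Hs w(2) add.right_neutral)
    qed
  }
qed

end
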